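(* Let $X,Y$ be countable subsets of $[0,\infty)$ and let $S\subset X\times Y$. If $S$ has the 2-link property, then the WEP holds for $S$.
   Context: For $S\subset X\times Y$: $S_X=\{x\in X:\exists y\in Y,\ (x,y)\in S\}$, $S_Y=\{y\in Y:\exists x\in X,\ (x,y)\in S\}$, and $Y(x)=\{y\in Y:(x,y)\in S\}$. The set $S$ has the 2-link property if there exists a numbering (a representation as a finite or infinite sequence without repetition) $S_X=(x_n)_{n\ge1}$ such that for all $n\ge1$ (in the index range) $\left|Y(x_n)\cap\bigcup_{i=1}^{n-1}Y(x_i)\right|\le2$, with the convention $\bigcup_{i=1}^0=\emptyset$. The WEP (weak exact predictable representation property) holds for $S$ if for every function $f:S\to\mathbb R$ there exist functions $\varphi,h:S_X\to\mathbb R$ and $\psi:S_Y\to\mathbb R$ with $f(x,y)=\varphi(x)+h(x)(y-x)-\psi(y)$ for all $(x,y)\in S$. *)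

theory Defs
  imports Complex_Main "HOL-Library.Countable_Set" "HOL-Library.Extended_Nat"
begin

definition proj_X :: "'a set \<Rightarrow> 'b set \<Rightarrow> ('a \<times> 'b) set \<Rightarrow> 'a set" where
  "proj_X X Y S = {x \<in> X. \<exists>y\<in>Y. (x, y) \<in> S}"

definition fibre :: "'b set \<Rightarrow> ('a \<times> 'b) set \<Rightarrow> 'a \<Rightarrow> 'b set" where
  "fibre Y S x = {y \<in> Y. (x, y) \<in> S}"

(* A finite or infinite sequence without repetition that exhausts A: the terms are
   u 1, ..., u N if N is finite (none if N = 0) and u 1, u 2, ... if N = \<infinity>. *)
definition numbering :: "enat \<Rightarrow> (nat \<Rightarrow> 'a) \<Rightarrow> 'a set \<Rightarrow> bool" where
  "numbering N u A \<longleftrightarrow> bij_betw u {n. 1 \<le> n \<and> enat n \<le> N} A"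

(* Fibres may be infinite and card is 0 on infinite sets, so finiteness is required
   separately. *)
definition two_link :: "'a set \<Rightarrow> 'b set \<Rightarrow> ('a \<times> 'b) set \<Rightarrow> bool" where
  "two_link X Y S \<longleftrightarrow>
    (\<exists>N u. numbering N u (proj_X X Y S) \<and>
      (\<forall>n. 1 \<le> n \<and> enat n \<le> N \<longrightarrow>
        finite (fibre Y S (u n) \<inter> (\<Union>i\<in>{1..<n}. fibre Y S (u i))) \<and>
        card (fibre Y S (u n) \<inter> (\<Union>i\<in>{1..<n}. fibre Y S (u i))) \<le> 2))"

(* f on S, \<phi> and h on S_X, and \<psi> on S_Y are represented by total functions: only values
   at (x, y) \<in> S, hence at x in S_X and y in S_Y, enter the equation, and every function on
   one of these sets extends to a total one. *)
definition WEP :: "(real \<times> real) set \<Rightarrow> bool" where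
  "WEP S \<longleftrightarrow>
    (\<forall>f :: real \<times> real \<Rightarrow> real. \<exists>(\<phi> :: real \<Rightarrow> real) (h :: real \<Rightarrow> real) (\<psi> :: real \<Rightarrow> real).
      \<forall>(x, y)\<in>S. f (x, y) = \<phi> x + h x * (y - x) - \<psi> y)"

end

theory Submission
  imports Defs
begin

text \<open>
  Process the points of the projection in the given order, choosing for each of them an affine
  function of \<open>y\<close>. The value of \<open>\<psi>\<close> at \<open>y\<close> is dictated by the first point whose fibre contains
  \<open>y\<close>. At every step at most two values of \<open>\<psi>\<close> on the current fibre are already fixed, and an
  affine function can take prescribed values at two points.
\<close>

text \<open>The shift by \<open>c\<close> only changes the constant term. With \<open>c\<close> the
  current point \<open>u n\<close>, the coefficients \<open>a\<close> and \<open>b\<close> serve as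
  the values of \<phi> and \<open>h\<close> there.\<close>

lemma affine_interpolation:
  fixes A :: "'a::field set" and v :: "'a \<Rightarrow> 'a"
  assumes "finite A" and "card A \<le> 2"
  shows "\<exists>a b. \<forall>y\<in>A. a + b * (y - c) = v y"
proof -
  consider "card A = 0" | "card A = 1" | "card A = 2"
    using assms(2) by linarith
  then show ?thesis
  proof cases
    case 1
    then show ?thesis using assms(1) by simp
  next
    case 2
    then obtain p where "A = {p}" by (auto simp: card_1_singleton_iff)
    then have "\<forall>y\<in>A. v p + 0 * (y - c) = v y" by simp
    then show ?thesis by blast
  next
    case 3
    then obtain p q where A: "A = {p, q}" and "p \<noteq> q" by (auto simp: card_2_iff)
    define b where "b = (v q - v p) / (q - p)"
    have b: "b * (q - p) = v q - v p" using \<open>p \<noteq> q\<close> by (simp add: b_def)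
    have "(v p - b * (p - c)) + b * (q - c) = v p + b * (q - p)" by (simp add: algebra_simps)
    then have "\<forall>y\<in>A. (v p - b * (p - c)) + b * (y - c) = v y" using b A by simp
    then show ?thesis by blast
  qed
qed

theorem proposition5p4:
  fixes X Y :: "real set" and S :: "(real \<times> real) set"
  assumes "countable X" and "countable Y"
    and "X \<subseteq> {0..}" and "Y \<subseteq> {0..}"
    and "S \<subseteq> X \<times> Y"
    and "two_link X Y S"
  shows "WEP S"
  unfolding WEP_def
proof
  fix f :: "real \<times> real \<Rightarrow> real"
  obtain N u where num: "numbering N u (proj_X X Y S)"
    and link: "\<And>n. 1 \<le> n \<Longrightarrow> enat n \<le> N \<Longrightarrow>
        finite (fibre Y S (u n) \<inter> (\<Union>i\<in>{1..<n}. fibre Y S (u i))) \<and>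
        card (fibre Y S (u n) \<inter> (\<Union>i\<in>{1..<n}. fibre Y S (u i))) \<le> 2"
    using assms(6) unfolding two_link_def by blast
  define I where "I = {n. 1 \<le> n \<and> enat n \<le> N}"
  define old where "old n = fibre Y S (u n) \<inter> (\<Union>i\<in>{1..<n}. fibre Y S (u i))" for n
  \<comment> \<open>Indices beyond \<open>N\<close> are harmless: if \<open>y\<close> lies in a
    fibre with index in \<open>I\<close>, the least index is no larger and so belongs to
    \<open>I\<close> too.\<close>
  define first where "first y = (LEAST i. 1 \<le> i \<and> y \<in> fibre Y S (u i))" for y
  \<comment> \<open>\<open>g n\<close> holds the pair (\<phi>, \<open>h\<close>) at
    \<open>u n\<close>. Solving the required equation at the first point for \<psi> gives this
    formula; \<open>g\<close> is a parameter because it is still to be constructed.\<close>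
  define psi where "psi g y = fst (g (first y)) + snd (g (first y)) * (y - u (first y))
      - f (u (first y), y)" for g :: "nat \<Rightarrow> real \<times> real" and y
  have first_less: "first y < n" if "y \<in> old n" for y n
  proof -
    obtain i where "1 \<le> i" "i < n" "y \<in> fibre Y S (u i)"
      using \<open>y \<in> old n\<close> unfolding old_def by auto
    then show ?thesis unfolding first_def by (metis (mono_tags, lifting) Least_le le_less_trans)
  qed
  \<comment> \<open>Vacuous outside \<open>I\<close>, so that the recursion can run over all
    naturals even when the numbering is finite.\<close>
  define P where "P g n p \<longleftrightarrow> (n \<in> I \<longrightarrow>
      (\<forall>y\<in>old n. fst p + snd p * (y - u n) = f (u n, y) + psi g y))" for g n p
  have "\<exists>g. \<forall>n. P g n (g n)"
  \<comment> \<open>The rule needs \<open>P g n\<close> to depend only on \<open>g\<close> below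
    \<open>n\<close>; this holds since \<open>first y < n\<close> on \<open>old n\<close>.\<close>
  proof (rule dependent_wellorder_choice)
    fix p and g g' :: "nat \<Rightarrow> real \<times> real" and n :: nat
    assume "\<And>m. m < n \<Longrightarrow> g m = g' m"
    then have "psi g y = psi g' y" if "y \<in> old n" for y
      using first_less[OF that] unfolding psi_def by simp
    then show "P g n p = P g' n p" unfolding P_def by simp
  next
    fix n and g :: "nat \<Rightarrow> real \<times> real"
    show "\<exists>p. P g n p"
    proof (cases "n \<in> I")
      case True
      then have "finite (old n)" "card (old n) \<le> 2"
        using link[of n] unfolding I_def old_def by auto
      from affine_interpolation[OF this, of "u n" "\<lambda>y. f (u n, y) + psi g y"]
      show ?thesis unfolding P_def by auto
    qed (simp add: P_def)
  qed
  then obtain g where g: "\<And>n. P g n (g n)" by blast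
  define index where "index = inv_into I u"
  have bij: "bij_betw u I (proj_X X Y S)"
    using num unfolding numbering_def I_def .
  have "f (x, y) = fst (g (index x)) + snd (g (index x)) * (y - x) - psi g y"
    if xy: "(x, y) \<in> S" for x y
  proof -
    have "x \<in> proj_X X Y S" and y: "y \<in> fibre Y S x"
      using xy assms(5) unfolding proj_X_def fibre_def by auto
    then have n: "index x \<in> I" "u (index x) = x"
      using bij unfolding index_def
      by (auto simp: bij_betw_def inv_into_into f_inv_into_f)
    show ?thesis
    \<comment> \<open>On old values the equation is the interpolation condition \<open>P\<close>. On
      new ones \<open>x\<close> is itself the first point, and the equation is the definition of
      \<open>psi\<close>.\<close>
    proof (cases "y \<in> old (index x)")
      case True
      then show ?thesis using g[of "index x"] n unfolding P_def by auto
    next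
      case False
      have "first y = index x" unfolding first_def
      proof (rule Least_equality)
        show "1 \<le> index x \<and> y \<in> fibre Y S (u (index x))"
          using n y unfolding I_def by simp
        show "index x \<le> i" if "1 \<le> i \<and> y \<in> fibre Y S (u i)" for i
          using that False y n unfolding old_def by (auto simp: not_less[symmetric])
      qed
      then show ?thesis using n unfolding psi_def by simp
    qed
  qed
  then show "\<exists>\<phi> h \<psi>. \<forall>(x, y)\<in>S. f (x, y) = \<phi> x + h x * (y - x) - \<psi> y"
    by (intro exI[of _ "\<lambda>x. fst (g (index x))"] exI[of _ "\<lambda>x. snd (g (index x))"]
        exI[of _ "psi g"]) auto
qed

end
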